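(* If $k$ and $j$ are non-negative integers, then $$\frac{1}{(q;q)_{\infty}^3}=q^{-\frac{k^2+k}{2}}\sum_{m=0}^{j} \binom{2m+2k+1}{m+2k+1}A_{m+k}(q) + O\left(q^{\frac{(j+1)(j+2k+2)}{2}}\right).$$ In particular, if $n$ is a non-negative integer with $n<(j+1)(j+2k+2)/2$, then $$p_3(n)= \sum_{m=0}^j \binom{2m+2k+1}{m+2k+1}\,\mathfrak{m}\left(m+k;\,n+\frac{k^2+k}{2}\right).$$
   Context: All identities are between formal (Laurent) power series in $q$, and $O(q^N)$ denotes a power series in $q$ all of whose terms have exponent at least $N$. The $q$-Pochhammer symbol is $(a;q)_\infty:=(1-a)(1-aq)(1-aq^2)\cdots$, so $(q;q)_\infty=\prod_{n\ge1}(1-q^n)$. For a positive integer $k$, MacMahon's $q$-series is $$A_k(q):=\sum_{0<s_1<s_2<\cdots<s_k}\frac{q^{s_1+s_2+\cdots+s_k}}{(1-q^{s_1})^2(1-q^{s_2})^2\cdots(1-q^{s_k})^2},$$ where the sum runs over strictly increasing $k$-tuples of positive integers, and $A_0(q):=1$. For non-negative integers $k,n$, $\mathfrak{m}(k;n)$ denotes the coefficient of $q^n$ in $A_k(q)$ (so $\mathfrak m(0;0)=1$ and $\mathfrak m(0;n)=0$ for $n\ge1$). The 3-colored partition function $p_3(n)$ is the number of partitions of $n$ in which each part is assigned one of three colors; its generating function is $\sum_{n\ge0}p_3(n)q^n=1/(q;q)_\infty^3$. *)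

theory Defs
  imports
    "HOL-Analysis.Analysis"
    "HOL-Computational_Algebra.Computational_Algebra"
    "HOL-Library.Multiset"
begin

(* All series have rational coefficients, and the variable q is fps_X (fls_X for Laurent
   series). Infinite sums and products are taken in the X-adic topology that the library
   puts on formal power series. *)

definition qpochhammer_inf :: "rat fps \<Rightarrow> rat fps" where
  "qpochhammer_inf a = (\<Prod>n. 1 - a * fps_X ^ n)"

(* A k-tuple s_1 < ... < s_k is the list [s_1, ..., s_k]. *)
definition increasing_tuples :: "nat \<Rightarrow> nat list set" where
  "increasing_tuples k =
     {s. length s = k \<and> sorted_wrt (<) s \<and> (\<forall>x\<in>set s. 0 < x)}"

definition MacMahon_A :: "nat \<Rightarrow> rat fps" where
  "MacMahon_A k =
     (\<Sum>\<^sub>\<infinity>s\<in>increasing_tuples k. fps_X ^ sum_list s / (\<Prod>x\<leftarrow>s. (1 - fps_X ^ x)\<^sup>2))"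

definition MacMahon_coeff :: "nat \<Rightarrow> nat \<Rightarrow> rat" where
  "MacMahon_coeff k n = fps_nth (MacMahon_A k) n"

(* A 3-colored partition is the multiset of its parts, each paired with a color from the
   three-element type 3. *)
definition colored_partitions3 :: "nat \<Rightarrow> (nat \<times> 3) multiset set" where
  "colored_partitions3 n =
     {P. (\<forall>(part, color)\<in>#P. 0 < part) \<and> (\<Sum>(part, color)\<in>#P. part) = n}"

definition p3 :: "nat \<Rightarrow> nat" where
  "p3 n = card (colored_partitions3 n)"

(* The set of power series that the notation O(q^N) may stand for. *)
definition O_q :: "nat \<Rightarrow> rat fps set" where
  "O_q N = {R. \<forall>i<N. fps_nth R i = 0}"

(* Hence halving these exponents with div on nat is exact. *)
lemma even_shift_exponent: "even (k\<^sup>2 + k)" for k :: nat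
  by (simp add: power2_eq_square)

lemma even_error_exponent: "even ((j + 1) * (j + 2 * k + 2))" for j k :: nat
  by simp

lemma MacMahon_A_0: "MacMahon_A 0 = 1"
proof -
  have "increasing_tuples 0 = {[]}"
    by (auto simp: increasing_tuples_def)
  then show ?thesis
    by (simp add: MacMahon_A_def)
qed

(* infsum is 0 on families that are not summable and prodinf is arbitrary on products that
   do not converge; likewise card is 0 on infinite sets. The lemmas below exclude these cases. *)
lemma MacMahon_A_summable:
  "(\<lambda>s. fps_X ^ sum_list s / (\<Prod>x\<leftarrow>s. (1 - fps_X ^ x)\<^sup>2) :: rat fps)
     summable_on increasing_tuples k"
proof -
  let ?F = "\<lambda>s. fps_X ^ sum_list s / (\<Prod>x\<leftarrow>s. (1 - fps_X ^ x)\<^sup>2) :: rat fps"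
  have fin: "finite {s \<in> increasing_tuples k. fps_nth (?F s) n \<noteq> 0}" for n
  proof (rule finite_subset)
    show "finite {s :: nat list. set s \<subseteq> {..n} \<and> length s = k}"
      by (intro finite_lists_length_eq) auto
    show "{s \<in> increasing_tuples k. fps_nth (?F s) n \<noteq> 0}
            \<subseteq> {s. set s \<subseteq> {..n} \<and> length s = k}"
    proof safe
      fix s x assume s: "s \<in> increasing_tuples k" and nz: "fps_nth (?F s) n \<noteq> 0" and x: "x \<in> set s"
      have "\<forall>x\<in>set s. 0 < x" using s by (simp add: increasing_tuples_def)
      then have "fps_nth (\<Prod>x\<leftarrow>s. (1 - fps_X ^ x)\<^sup>2 :: rat fps) 0 = 1"
        by (induction s) (auto simp: fps_nth_power_0 power_0_left)
      then have "?F s = fps_X ^ sum_list s * inverse (\<Prod>x\<leftarrow>s. (1 - fps_X ^ x)\<^sup>2)"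
        by (intro fps_divide_unit) simp
      then have "sum_list s \<le> n"
        using nz by (auto simp: fps_X_power_mult_nth split: if_splits)
      with member_le_sum_list[OF x] show "x \<le> n" by simp
    qed (auto simp: increasing_tuples_def)
  qed
  have "(?F has_sum Abs_fps (\<lambda>n. \<Sum>s | s \<in> increasing_tuples k \<and> fps_nth (?F s) n \<noteq> 0.
           fps_nth (?F s) n)) (increasing_tuples k)"
    by (rule has_sum_fpsI) (use fin in auto)
  then show ?thesis by (rule has_sum_imp_summable)
qed

lemma qpochhammer_inf_has_prod:
  "(\<lambda>n. 1 - fps_X * fps_X ^ n) has_prod qpochhammer_inf fps_X"
proof -
  let ?P = "\<lambda>n. \<Prod>i\<le>n. 1 - fps_X * fps_X ^ i :: rat fps"
  have step: "fps_nth (?P (Suc n)) m = fps_nth (?P n) m" if "m \<le> n" for m n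
  proof -
    have "?P (Suc n) = ?P n - ?P n * fps_X ^ Suc (Suc n)"
      by (simp add: right_diff_distrib)
    then show ?thesis using that by (simp only: fps_sub_nth fps_X_power_mult_right_nth) simp
  qed
  have stable: "fps_nth (?P n) m = fps_nth (?P m) m" if "m \<le> n" for m n
    using that by (induction rule: dec_induct) (simp_all add: step del: prod.atMost_Suc)
  have lim: "?P \<longlonglongrightarrow> Abs_fps (\<lambda>m. fps_nth (?P m) m)"
    by (rule tendsto_fpsI)
      (auto intro!: eventually_mono[OF eventually_ge_at_top] stable)
  moreover have "Abs_fps (\<lambda>m. fps_nth (?P m) m) \<noteq> 0"
    by (auto simp: fps_eq_iff intro!: exI[of _ 0])
  ultimately have "(\<lambda>n. 1 - fps_X * fps_X ^ n :: rat fps) has_prod Abs_fps (\<lambda>m. fps_nth (?P m) m)"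
    by (simp add: has_prod_def raw_has_prod_def)
  with has_prod_unique[OF this] show ?thesis
    by (simp add: qpochhammer_inf_def)
qed

lemma finite_colored_partitions3: "finite (colored_partitions3 n)"
proof (rule finite_subset)
  let ?B = "\<Union>i\<le>n. multisets_of_size ({..n} \<times> (UNIV :: 3 set)) i"
  show "finite ?B"
    by (intro finite_UN_I finite_multisets_of_size finite_cartesian_product) simp_all
  show "colored_partitions3 n \<subseteq> ?B"
  proof
    fix P assume P: "P \<in> colored_partitions3 n"
    have "size P \<le> (\<Sum>(part, color)\<in>#P. part)" if "\<forall>(part, color)\<in>#P. 0 < part" for P :: "(nat \<times> 3) multiset"
      using that by (induction P) auto
    moreover have "part \<le> n" if "(part, color) \<in># P" for part color
    proof -
      from that obtain Q where "P = add_mset (part, color) Q" by (metis mset_add)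
      then show ?thesis using P by (auto simp: colored_partitions3_def)
    qed
    ultimately have "set_mset P \<subseteq> {..n} \<times> UNIV" "size P \<le> n"
      using P by (auto simp: colored_partitions3_def)
    then show "P \<in> ?B" by (auto simp: multisets_of_size_def)
  qed
qed

end

theory Submission
  imports Defs "HOL-Library.Nat_Bijection"
begin

text \<open>
  Let \<open>a\<^sub>l\<close> be the sum defining \<open>A\<^sub>l\<close> restricted to tuples with entries at most \<open>N\<close>. Then
  \<open>\<Sum>\<^sub>l a\<^sub>l x\<^sup>l = \<Prod>\<^sub>n\<^sub>\<le>\<^sub>N (1 + x q\<^sup>n / (1 - q\<^sup>n)\<^sup>2)\<close>, and for \<open>x = (1 + w)\<^sup>2 / w\<close> the numerator of each
  factor is \<open>(1 + w q\<^sup>n) (1 + q\<^sup>n / w)\<close>. Expand instead in the polynomials \<open>T\<^sub>k(x)\<close> with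
  \<open>x T\<^sub>k = T\<^sub>k\<^sub>+\<^sub>1 + 2 T\<^sub>k + T\<^sub>k\<^sub>-\<^sub>1\<close> and \<open>T\<^sub>-\<^sub>1 = T\<^sub>0 = 1\<close>: since \<open>x\<^sup>l\<close> is the sum of the
  \<open>(2 l + 1 choose l + k + 1) T\<^sub>k\<close>, the coefficient of \<open>T\<^sub>k\<close> is the binomial combination of the \<open>a\<^sub>l\<close>
  occurring in the theorem. It obeys a three-term recurrence in \<open>N\<close>, solved by
  \<open>q\<^bsup>k(k+1)/2\<^esup>\<close> times the Gaussian binomial of \<open>2 N + 1\<close> over \<open>N + k + 1\<close>, divided by
  \<open>(q;q)\<^sub>N\<^sup>2\<close>. This is a finite form of the Jacobi triple product; letting \<open>N\<close> tend to infinity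
  gives \<open>q\<^bsup>k(k+1)/2\<^esup> / (q;q)\<^sub>\<infinity>\<^sup>3\<close>. Finally \<open>A\<^sub>l\<close> has order at least \<open>l(l+1)/2\<close>, so truncating
  the sum causes only the stated error.
\<close>

section \<open>The products \<open>(q;q)_n\<close> and Gaussian binomials\<close>

definition qfact :: "'a::comm_ring_1 \<Rightarrow> nat \<Rightarrow> 'a" where
  "qfact q n = (\<Prod>i<n. 1 - q ^ Suc i)"

lemma qfact_0 [simp]: "qfact q 0 = 1"
  by (simp add: qfact_def)

lemma qfact_Suc [simp]: "qfact q (Suc n) = qfact q n * (1 - q ^ Suc n)"
  by (simp add: qfact_def)

text \<open>The recursion is the q-Pascal rule, so no division is required and \<open>q\<close> may
  lie in any commutative ring.\<close>

fun qbinomial :: "'a::comm_ring_1 \<Rightarrow> nat \<Rightarrow> nat \<Rightarrow> 'a" where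
  "qbinomial q n 0 = 1"
| "qbinomial q 0 (Suc k) = 0"
| "qbinomial q (Suc n) (Suc k) = qbinomial q n k + q ^ Suc k * qbinomial q n (Suc k)"

lemma qbinomial_eq_0: "n < k \<Longrightarrow> qbinomial q n k = 0"
  by (induction q n k rule: qbinomial.induct) auto

text \<open>The quotient formula in division-free form. The q-Pascal rule turns the induction step
  into \<open>(1 - q ^ m) + q ^ m * (1 - q ^ n) = 1 - q ^ (m + n)\<close>.\<close>

lemma qbinomial_qfact: "qbinomial q (m + n) m * qfact q m * qfact q n = qfact q (m + n)"
proof (induction "m + n" arbitrary: m n)
  case 0
  then show ?case by simp
next
  case (Suc p)
  show ?case
  proof (cases "m = 0 \<or> n = 0")
    case True
    have "qbinomial q m m = 1" for m
      by (induction m) (auto simp: qbinomial_eq_0)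
    with True show ?thesis by (auto simp del: qfact_Suc)
  next
    case False
    then obtain m' n' where mn: "m = Suc m'" "n = Suc n'"
      by (metis not0_implies_Suc)
    have 1: "qbinomial q p m' * qfact q m' * qfact q (Suc n') = qfact q p"
      using Suc(1)[of m' "Suc n'"] Suc(2) mn by simp
    have 2: "qbinomial q p (Suc m') * qfact q (Suc m') * qfact q n' = qfact q p"
      using Suc(1)[of "Suc m'" n'] Suc(2) mn by simp
    have p: "p = m' + Suc n'" "m + n = Suc p"
      using Suc(2) mn by auto
    have "qbinomial q (m + n) m * qfact q m * qfact q n =
        (qbinomial q p m' + q ^ Suc m' * qbinomial q p (Suc m')) * qfact q (Suc m') * qfact q (Suc n')"
      by (simp add: mn(1,2) p(2)[symmetric, unfolded mn] del: qfact_Suc) (simp add: p mn del: qfact_Suc)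
    also have "\<dots> = (qbinomial q p m' * qfact q m' * qfact q (Suc n')) * (1 - q ^ Suc m')
        + q ^ Suc m' * (qbinomial q p (Suc m') * qfact q (Suc m') * qfact q n') * (1 - q ^ Suc n')"
      by (simp add: algebra_simps)
    also have "\<dots> = qfact q p * (1 - q ^ Suc m' * q ^ Suc n')"
      unfolding 1 2 by (simp add: algebra_simps)
    also have "q ^ Suc m' * q ^ Suc n' = q ^ Suc p"
      by (simp add: p power_add)
    finally show ?thesis by (simp add: p)
  qed
qed

text \<open>The other Pascal rule, multiplied by \<open>q ^ k\<close> so that the exponent \<open>n - k\<close> does not occur.\<close>
lemma qbinomial_Suc_Suc':
  "q ^ k * qbinomial q (Suc n) (Suc k) = q ^ n * qbinomial q n k + q ^ k * qbinomial q n (Suc k)"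
proof (induction n arbitrary: k)
  case 0
  then show ?case by (cases k) auto
next
  case (Suc n)
  show ?case
  proof (cases k)
    case 0
    have "qbinomial q (Suc n) 1 = 1 + q * qbinomial q n 1" by simp
    moreover have "qbinomial q (Suc n) 1 = q ^ n + qbinomial q n 1"
      using Suc[of 0] by simp
    ultimately show ?thesis using 0 by (simp add: algebra_simps)
  next
    case (Suc k')
    have 1: "q ^ k' * qbinomial q (Suc n) (Suc k') = q ^ n * qbinomial q n k' + q ^ k' * qbinomial q n (Suc k')"
      and 2: "q ^ k * qbinomial q (Suc n) (Suc k) = q ^ n * qbinomial q n k + q ^ k * qbinomial q n (Suc k)"
      by (rule Suc.IH)+
    \<comment> \<open>Expand by the defining rule, apply the induction hypothesis at
      \<open>k'\<close> and at \<open>k\<close>, and regroup so that the defining rule can be read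
      backwards.\<close>
    have "q ^ k * qbinomial q (Suc (Suc n)) (Suc k) =
        q * (q ^ k' * qbinomial q (Suc n) (Suc k')) + q ^ Suc k * (q ^ k * qbinomial q (Suc n) (Suc k))"
      by (simp add: Suc algebra_simps)
    also have "\<dots> = q ^ Suc n * (qbinomial q n k' + q ^ k * qbinomial q n k) +
        q ^ k * (qbinomial q n (Suc k') + q ^ Suc k * qbinomial q n (Suc k))"
      unfolding 1 2 by (simp add: Suc algebra_simps)
    finally show ?thesis by (simp add: Suc)
  qed
qed

section \<open>MacMahon's series truncated to entries at most \<open>N\<close>\<close>

definition bounded_tuples :: "nat \<Rightarrow> nat \<Rightarrow> nat list set" where
  "bounded_tuples k N = {s \<in> increasing_tuples k. set s \<subseteq> {..N}}"

lemma finite_bounded_tuples: "finite (bounded_tuples k N)"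
  by (rule finite_subset[OF _ finite_lists_length_eq[of "{..N}" k]])
    (auto simp: bounded_tuples_def increasing_tuples_def)

lemma bounded_tuples_0: "bounded_tuples 0 N = {[]}"
  by (auto simp: bounded_tuples_def increasing_tuples_def)

lemma bounded_tuples_Suc_0: "bounded_tuples (Suc k) 0 = {}"
  by (fastforce simp: bounded_tuples_def increasing_tuples_def length_Suc_conv)

text \<open>Since entries increase, \<open>Suc N\<close> can only be the last one. This corresponds
  to multiplying the generating product by one more factor.\<close>

lemma bounded_tuples_Suc_Suc:
  "bounded_tuples (Suc k) (Suc N) =
     bounded_tuples (Suc k) N \<union> (\<lambda>s. s @ [Suc N]) ` bounded_tuples k N"
proof (intro equalityI subsetI)
  fix s assume s: "s \<in> bounded_tuples (Suc k) (Suc N)"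
  then have "s \<noteq> []" by (auto simp: bounded_tuples_def increasing_tuples_def)
  then obtain t x where tx: "s = t @ [x]" by (metis rev_exhaust)
  show "s \<in> bounded_tuples (Suc k) N \<union> (\<lambda>s. s @ [Suc N]) ` bounded_tuples k N"
  proof (cases "x = Suc N")
    case True
    with s tx have "t \<in> bounded_tuples k N"
      by (fastforce simp: bounded_tuples_def increasing_tuples_def sorted_wrt_append)
    with True tx show ?thesis by blast
  next
    case False
    with s tx have "s \<in> bounded_tuples (Suc k) N"
      by (fastforce simp: bounded_tuples_def increasing_tuples_def sorted_wrt_append)
    then show ?thesis by blast
  qed
next
  fix s assume "s \<in> bounded_tuples (Suc k) N \<union> (\<lambda>s. s @ [Suc N]) ` bounded_tuples k N"
  then show "s \<in> bounded_tuples (Suc k) (Suc N)"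
    by (fastforce simp: bounded_tuples_def increasing_tuples_def sorted_wrt_append)
qed

definition MacMahon_weight :: "nat \<Rightarrow> rat fps" where
  "MacMahon_weight n = fps_X ^ n * inverse ((1 - fps_X ^ n)\<^sup>2)"

definition MacMahon_trunc :: "nat \<Rightarrow> nat \<Rightarrow> rat fps" where
  "MacMahon_trunc k N = (\<Sum>s\<in>bounded_tuples k N. \<Prod>x\<leftarrow>s. MacMahon_weight x)"

lemma MacMahon_weight_mult:
  "0 < n \<Longrightarrow> MacMahon_weight n * (1 - fps_X ^ n)\<^sup>2 = fps_X ^ n"
  unfolding MacMahon_weight_def mult.assoc
  by (subst inverse_mult_eq_1) (simp_all add: power_0_left fps_nth_power_0)

lemma MacMahon_trunc_0 [simp]: "MacMahon_trunc 0 N = 1"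
  by (simp add: MacMahon_trunc_def bounded_tuples_0)

lemma MacMahon_trunc_Suc_0 [simp]: "MacMahon_trunc (Suc k) 0 = 0"
  by (simp add: MacMahon_trunc_def bounded_tuples_Suc_0)

lemma MacMahon_trunc_Suc_Suc [simp]:
  "MacMahon_trunc (Suc k) (Suc N) =
     MacMahon_trunc (Suc k) N + MacMahon_weight (Suc N) * MacMahon_trunc k N"
proof -
  have "bounded_tuples (Suc k) N \<inter> (\<lambda>s. s @ [Suc N]) ` bounded_tuples k N = {}"
    by (auto simp: bounded_tuples_def)
  then show ?thesis
    unfolding MacMahon_trunc_def bounded_tuples_Suc_Suc
    by (subst sum.union_disjoint)
      (auto simp: finite_bounded_tuples sum.reindex inj_on_def sum_distrib_left mult.commute)
qed

lemma MacMahon_trunc_eq_0: "N < k \<Longrightarrow> MacMahon_trunc k N = 0"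
proof (induction N arbitrary: k)
  case 0
  then show ?case by (cases k) auto
next
  case (Suc N)
  then show ?case by (cases k) auto
qed

section \<open>The coefficients of \<open>T_k\<close> and their closed form\<close>

text \<open>Multiplication by \<open>(1 + y)^2\<close>, read off coefficientwise; it is the source
  of \<open>x T_k = T_(k+1) + 2 T_k + T_(k-1)\<close>.\<close>

lemma binomial_two_steps:
  "(n + 2) choose (k + 2) = (n choose (k + 2)) + 2 * (n choose (k + 1)) + (n choose k)"
  by (simp add: numeral_2_eq_2)

text \<open>The coefficient of \<open>T_k\<close> in the generating polynomial. Terms with
  \<open>l < k\<close> vanish with their binomial coefficient.\<close>

definition MacMahon_comb :: "nat \<Rightarrow> nat \<Rightarrow> rat fps" where
  "MacMahon_comb k N = (\<Sum>l\<le>N. of_nat ((2 * l + 1) choose (l + k + 1)) * MacMahon_trunc l N)"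

text \<open>With \<open>Q = fps_X ^ Suc N\<close>, the new factor times \<open>(1 - Q)^2\<close> is
  \<open>(1 - Q)^2 + x Q\<close>. Multiplication by \<open>x\<close> sends the coefficient at
  \<open>k\<close> to twice itself plus its two neighbours, and
  \<open>(1 - Q)^2 + 2 Q = 1 + Q^2\<close>. The case distinction on \<open>k\<close> encodes
  \<open>T_(-1) = T_0\<close>.\<close>

lemma MacMahon_comb_Suc:
  "(1 - fps_X ^ Suc N)\<^sup>2 * MacMahon_comb k (Suc N) =
     (1 + fps_X ^ (2 * Suc N)) * MacMahon_comb k N +
     fps_X ^ Suc N * (MacMahon_comb (if k = 0 then 0 else k - 1) N + MacMahon_comb (Suc k) N)"
proof -
  define Q :: "rat fps" where "Q = fps_X ^ Suc N"
  define c where "c k l = (of_nat ((2 * l + 1) choose (l + k + 1)) :: rat fps)" for k l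
  let ?k' = "if k = 0 then 0 else k - 1"
  have c: "c k (Suc l) = c ?k' l + 2 * c k l + c (Suc k) l" for l
  proof -
    have "(2 * Suc l + 1) choose (Suc l + k + 1) =
        ((2 * l + 1) choose (l + k + 2)) + 2 * ((2 * l + 1) choose (l + k + 1)) + ((2 * l + 1) choose (l + k))"
      using binomial_two_steps[of "2 * l + 1" "l + k"] by (simp add: add_ac)
    \<comment> \<open>For \<open>k = 0\<close> the two middle binomial coefficients of an odd row
      agree.\<close>
    moreover have "(2 * l + 1) choose (l + k) = (2 * l + 1) choose (l + ?k' + 1)"
      using binomial_symmetric[of l "2 * l + 1"] by (cases k) auto
    ultimately show ?thesis
      unfolding c_def by (simp add: algebra_simps)
  qed
  have Qg: "(1 - Q)\<^sup>2 * MacMahon_weight (Suc N) = Q"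
    unfolding Q_def using MacMahon_weight_mult[of "Suc N"] by (simp only: mult.commute)
  have "MacMahon_comb k (Suc N) = c k 0 + (\<Sum>l\<le>N. c k (Suc l) * MacMahon_trunc (Suc l) (Suc N))"
    unfolding MacMahon_comb_def c_def[symmetric] sum.atMost_Suc_shift by simp
  also have "\<dots> = (c k 0 * MacMahon_trunc 0 N + (\<Sum>l\<le>N. c k (Suc l) * MacMahon_trunc (Suc l) N)) +
      MacMahon_weight (Suc N) * (\<Sum>l\<le>N. c k (Suc l) * MacMahon_trunc l N)"
    by (simp add: algebra_simps sum.distrib sum_distrib_left)
  \<comment> \<open>The shifted sum runs up to \<open>l = Suc N\<close>, where
    \<open>MacMahon_trunc l N\<close> is zero.\<close>
  also have "c k 0 * MacMahon_trunc 0 N + (\<Sum>l\<le>N. c k (Suc l) * MacMahon_trunc (Suc l) N) = MacMahon_comb k N"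
    unfolding MacMahon_comb_def c_def[symmetric]
    using sum.atMost_Suc_shift[of "\<lambda>l. c k l * MacMahon_trunc l N" N] by (simp add: MacMahon_trunc_eq_0)
  also have "(\<Sum>l\<le>N. c k (Suc l) * MacMahon_trunc l N) =
      MacMahon_comb ?k' N + 2 * MacMahon_comb k N + MacMahon_comb (Suc k) N"
    unfolding MacMahon_comb_def c_def[symmetric] c
    by (simp add: algebra_simps sum.distrib sum_distrib_left)
  finally have "(1 - Q)\<^sup>2 * MacMahon_comb k (Suc N) = (1 - Q)\<^sup>2 * MacMahon_comb k N +
      ((1 - Q)\<^sup>2 * MacMahon_weight (Suc N)) *
      (MacMahon_comb ?k' N + 2 * MacMahon_comb k N + MacMahon_comb (Suc k) N)"
    by (simp only: algebra_simps)
  also have "\<dots> = (1 + Q\<^sup>2) * MacMahon_comb k N + Q * (MacMahon_comb ?k' N + MacMahon_comb (Suc k) N)"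
    unfolding Qg by (simp add: algebra_simps power2_eq_square)
  finally show ?thesis
    unfolding Q_def by (simp only: power_mult[symmetric] mult.commute)
qed

text \<open>Induction on \<open>N\<close>: both sides agree for \<open>N = 0\<close>, where only
  \<open>k = 0\<close> survives, and the recurrence \<open>MacMahon_comb_Suc\<close> matches two
  q-Pascal steps from row \<open>2 N + 1\<close> to row \<open>2 N + 3\<close>. Here
  \<open>triangle k\<close> is \<open>k (k + 1) / 2\<close>.\<close>

lemma MacMahon_comb_eq:
  "MacMahon_comb k N * (qfact fps_X N)\<^sup>2 =
     fps_X ^ triangle k * qbinomial fps_X (2 * N + 1) (N + k + 1)"
proof (induction N arbitrary: k)
  case 0
  show ?case by (cases k) (auto simp: MacMahon_comb_def)
next
  case (Suc N)
  let ?X = "fps_X :: rat fps" and ?B = "qbinomial (fps_X :: rat fps) (2 * N + 1)"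
  let ?k' = "if k = 0 then 0 else k - 1"
  have "MacMahon_comb k (Suc N) * (qfact ?X (Suc N))\<^sup>2 =
      ((1 - ?X ^ Suc N)\<^sup>2 * MacMahon_comb k (Suc N)) * (qfact ?X N)\<^sup>2"
    unfolding qfact_Suc power_mult_distrib by (simp only: mult_ac)
  also have "\<dots> = (1 + ?X ^ (2 * Suc N)) * (MacMahon_comb k N * (qfact ?X N)\<^sup>2) +
      ?X ^ Suc N * (MacMahon_comb ?k' N * (qfact ?X N)\<^sup>2 + MacMahon_comb (Suc k) N * (qfact ?X N)\<^sup>2)"
    unfolding MacMahon_comb_Suc by (simp only: algebra_simps)
  also have "\<dots> = (1 + ?X ^ (2 * Suc N)) * (?X ^ triangle k * ?B (N + k + 1)) +
      ?X ^ Suc N * (?X ^ triangle ?k' * ?B (N + ?k' + 1) + ?X ^ triangle (Suc k) * ?B (N + k + 2))"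
    unfolding Suc.IH by (simp add: numeral_2_eq_2)
  \<comment> \<open>For \<open>k = 0\<close> this is the symmetry of row \<open>2 N + 1\<close>
    about its middle; the q-factorials may be cancelled as their constant term is 1.\<close>
  also have "?X ^ triangle ?k' * ?B (N + ?k' + 1) = ?X ^ triangle ?k' * ?B (N + k)"
  proof (cases "k = 0")
    case True
    have "?B N * qfact ?X N * qfact ?X (N + 1) = ?B (N + 1) * qfact ?X (N + 1) * qfact ?X N"
      using qbinomial_qfact[of ?X N "N + 1"] qbinomial_qfact[of ?X "N + 1" N]
      by (simp add: mult_2 del: qfact_Suc)
    moreover have "qfact ?X n \<noteq> 0" for n
    proof -
      have "fps_nth (qfact ?X n) 0 = 1"
        by (induction n) (auto simp: power_0_left)
      then show ?thesis by auto
    qed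
    ultimately show ?thesis using True by (auto simp: mult_ac simp del: qfact_Suc)
  qed (auto)
  also have "(1 + ?X ^ (2 * Suc N)) * (?X ^ triangle k * ?B (N + k + 1)) +
      ?X ^ Suc N * (?X ^ triangle ?k' * ?B (N + k) + ?X ^ triangle (Suc k) * ?B (N + k + 2)) =
      ?X ^ triangle k * qbinomial ?X (2 * Suc N + 1) (Suc N + k + 1)"
  proof -
    \<comment> \<open>One step up uses the defining rule (\<open>P\<close>), the other the second
      Pascal rule (\<open>P2\<close>, \<open>P3\<close>). The latter carries a power of
      \<open>q\<close>, so the identity is first proved multiplied by \<open>?X ^ (N + k)\<close>,
      which is cancelled at the end.\<close>
    have P: "qbinomial ?X (2 * Suc N + 1) (Suc N + k + 1) =
        qbinomial ?X (Suc (2 * N + 1)) (Suc (N + k)) +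
        ?X ^ (N + k + 2) * qbinomial ?X (Suc (2 * N + 1)) (Suc (N + k + 1))"
      by simp
    have P2: "?X ^ (N + k) * qbinomial ?X (Suc (2 * N + 1)) (Suc (N + k)) =
        ?X ^ (2 * N + 1) * ?B (N + k) + ?X ^ (N + k) * ?B (N + k + 1)"
      using qbinomial_Suc_Suc'[of ?X "N + k" "2 * N + 1"] by simp
    have P3: "?X ^ (N + k + 1) * qbinomial ?X (Suc (2 * N + 1)) (Suc (N + k + 1)) =
        ?X ^ (2 * N + 1) * ?B (N + k + 1) + ?X ^ (N + k + 1) * ?B (N + k + 2)"
      using qbinomial_Suc_Suc'[of ?X "N + k + 1" "2 * N + 1"] by simp
    have T: "?X ^ k * (?X ^ triangle ?k') = ?X ^ triangle k"
      by (cases k) (auto simp: power_add)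
    have "?X ^ (N + k) * (?X ^ triangle k * qbinomial ?X (2 * Suc N + 1) (Suc N + k + 1)) =
        ?X ^ triangle k * (?X ^ (N + k) * qbinomial ?X (Suc (2 * N + 1)) (Suc (N + k)) +
        ?X ^ (N + k + 1) * (?X ^ (N + k + 1) * qbinomial ?X (Suc (2 * N + 1)) (Suc (N + k + 1))))"
      unfolding P by (simp add: algebra_simps power_add)
    also have "\<dots> = ?X ^ (N + k) * (?X ^ triangle k * ((1 + ?X ^ (2 * Suc N)) * ?B (N + k + 1) +
       ?X ^ (N + k + 2) * ?B (N + k + 2))) + ?X ^ triangle k * ?X ^ (2 * N + 1) * ?B (N + k)"
      unfolding P2 P3 by (simp add: algebra_simps power_add mult_2 power2_eq_square)
    also have "?X ^ triangle k * ?X ^ (2 * N + 1) * ?B (N + k) =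
       ?X ^ (N + k) * (?X ^ Suc N * (?X ^ triangle ?k' * ?B (N + k)))"
    proof -
      have "?X ^ (2 * N + 1) = ?X ^ N * ?X ^ Suc N"
        by (simp only: power_add[symmetric] mult_2) simp
      then show ?thesis
        unfolding T[symmetric] by (simp only: power_add mult_ac)
    qed
    finally have "?X ^ (N + k) * (?X ^ triangle k * qbinomial ?X (2 * Suc N + 1) (Suc N + k + 1)) =
       ?X ^ (N + k) * ((1 + ?X ^ (2 * Suc N)) * (?X ^ triangle k * ?B (N + k + 1)) +
      ?X ^ Suc N * (?X ^ triangle ?k' * ?B (N + k) + ?X ^ triangle (Suc k) * ?B (N + k + 2)))"
      by (simp add: algebra_simps power_add power2_eq_square)
    then show ?thesis by (simp only: mult_cancel_left) simp
  qed
  finally show ?case by simp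
qed

section \<open>Congruences modulo powers of \<open>q\<close>, and \<open>(q;q)_N\<close> as an
  approximation of the infinite product\<close>

text \<open>Expresses agreement of initial coefficients as divisibility, so that approximations can
  be multiplied without handling coefficients.\<close>

lemma fps_X_power_dvd_iff: "fps_X ^ n dvd f \<longleftrightarrow> (\<forall>i<n. fps_nth f i = 0)"
  for f :: "'a::comm_ring_1 fps"
proof
  assume "\<forall>i<n. fps_nth f i = 0"
  then have "f = fps_X ^ n * fps_shift n f"
    by (auto simp: fps_eq_iff fps_X_power_mult_nth)
  then show "fps_X ^ n dvd f" by (rule dvdI)
qed (auto simp: fps_X_power_mult_nth elim!: dvdE)

lemma dvd_mult_diff_mult:
  fixes d :: "'a::comm_ring_1"
  assumes "d dvd a - b" "d dvd a' - b'"
  shows "d dvd a * a' - b * b'"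
proof -
  have "a * a' - b * b' = a * (a' - b') + (a - b) * b'"
    by (simp add: algebra_simps)
  with assms show ?thesis by simp
qed

lemma dvd_power_diff_power:
  fixes d :: "'a::comm_ring_1"
  shows "d dvd a - b \<Longrightarrow> d dvd a ^ n - b ^ n"
  by (induction n) (auto intro: dvd_mult_diff_mult)

text \<open>Every factor after the first \<open>N\<close> is 1 modulo
  \<open>q ^ Suc N\<close>.\<close>

lemma qfact_cong:
  assumes "N \<le> M"
  shows "q ^ Suc N dvd qfact q M - qfact q N"
  using assms
proof (induction M rule: dec_induct)
  case (step M)
  have "q ^ Suc N dvd (qfact q M - qfact q N) - qfact q M * q ^ Suc M"
    using step by (intro dvd_diff step.IH dvd_mult le_imp_power_dvd) auto
  then show ?case by (simp add: algebra_simps)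
qed auto

lemma qfact_cong_qpochhammer_inf:
  "fps_X ^ Suc N dvd qfact fps_X N - qpochhammer_inf fps_X"
proof -
  have "(\<lambda>n. \<Prod>i\<le>n. 1 - fps_X * fps_X ^ i) \<longlonglongrightarrow> qpochhammer_inf fps_X"
    by (rule has_prod_imp_tendsto) (rule qpochhammer_inf_has_prod)
  moreover have "(\<lambda>n. \<Prod>i\<le>n. 1 - fps_X * fps_X ^ i) = (\<lambda>n. qfact (fps_X :: rat fps) (Suc n))"
    by (simp add: qfact_def lessThan_Suc_atMost fun_eq_iff del: prod.lessThan_Suc)
  ultimately have lim: "(\<lambda>n. qfact (fps_X :: rat fps) (Suc n)) \<longlonglongrightarrow> qpochhammer_inf fps_X"
    by simp
  have "fps_nth (qfact fps_X N) i = fps_nth (qpochhammer_inf fps_X) i" if "i < Suc N" for i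
  proof -
    have "eventually (\<lambda>n. fps_nth (qfact (fps_X :: rat fps) (Suc n)) i = fps_nth (qpochhammer_inf fps_X) i) sequentially"
      using lim unfolding tendsto_fps_iff by blast
    then obtain n0 where n0: "\<And>n. n \<ge> n0 \<Longrightarrow>
        fps_nth (qfact (fps_X :: rat fps) (Suc n)) i = fps_nth (qpochhammer_inf fps_X) i"
      by (auto simp: eventually_sequentially)
    \<comment> \<open>Beyond \<open>n0\<close> the coefficient equals that of the limit; beyond
      \<open>N\<close> it equals that of \<open>qfact fps_X N\<close>.\<close>
    have "(fps_X :: rat fps) ^ Suc N dvd qfact fps_X (Suc (max n0 N)) - qfact fps_X N"
      by (rule qfact_cong) auto
    with that n0[of "max n0 N"] show ?thesis
      by (auto simp: fps_X_power_dvd_iff simp del: qfact_Suc power_Suc)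
  qed
  then show ?thesis by (auto simp: fps_X_power_dvd_iff simp del: power_Suc)
qed

lemma qpochhammer_inf_nth_0: "fps_nth (qpochhammer_inf fps_X) 0 = 1"
  using qfact_cong_qpochhammer_inf[of 0] by (simp add: fps_X_power_dvd_iff[of 1, simplified])

section \<open>Order of the truncated series, and \<open>MacMahon_A\<close> as their limit\<close>

lemma triangle_mono: "m \<le> n \<Longrightarrow> triangle m \<le> triangle n"
  by (induction rule: dec_induct) auto

text \<open>The least possible exponent is \<open>1 + ... + k\<close>. In the recurrence a new
  largest entry \<open>Suc N\<close> contributes \<open>fps_X ^ Suc N\<close>, and
  \<open>Suc N\<close> is at least \<open>Suc k'\<close> unless the remaining truncation is zero.
  This order gives the error term.\<close>

lemma MacMahon_trunc_dvd: "fps_X ^ triangle k dvd MacMahon_trunc k N"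
proof (induction N arbitrary: k)
  case 0
  then show ?case by (cases k) auto
next
  case (Suc N)
  show ?case
  proof (cases k)
    case (Suc k')
    have "fps_X ^ triangle (Suc k') dvd MacMahon_weight (Suc N) * MacMahon_trunc k' N"
    proof (cases "k' \<le> N")
      case True
      have "(fps_X :: rat fps) ^ Suc k' dvd fps_X ^ Suc N"
        using True by (intro le_imp_power_dvd) auto
      then have "fps_X ^ Suc k' dvd MacMahon_weight (Suc N)"
        unfolding MacMahon_weight_def by (rule dvd_mult2)
      then have "fps_X ^ Suc k' * fps_X ^ triangle k' dvd MacMahon_weight (Suc N) * MacMahon_trunc k' N"
        by (intro mult_dvd_mono Suc.IH)
      then show ?thesis by (simp add: power_add mult_ac)
    qed (simp add: MacMahon_trunc_eq_0)
    then show ?thesis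
      unfolding Suc MacMahon_trunc_Suc_Suc by (intro dvd_add Suc.IH)
  qed simp
qed

lemma MacMahon_summand_eq:
  assumes "\<forall>x\<in>set s. 0 < x"
  shows "fps_X ^ sum_list s / (\<Prod>x\<leftarrow>s. (1 - fps_X ^ x)\<^sup>2) = (\<Prod>x\<leftarrow>s. MacMahon_weight x)"
proof -
  have "fps_nth (\<Prod>x\<leftarrow>s. (1 - fps_X ^ x)\<^sup>2 :: rat fps) 0 = 1"
    using assms by (induction s) (auto simp: fps_nth_power_0 power_0_left)
  then have "fps_X ^ sum_list s / (\<Prod>x\<leftarrow>s. (1 - fps_X ^ x)\<^sup>2) =
      fps_X ^ sum_list s * inverse (\<Prod>x\<leftarrow>s. (1 - fps_X ^ x)\<^sup>2 :: rat fps)"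
    by (intro fps_divide_unit) simp
  also have "\<dots> = (\<Prod>x\<leftarrow>s. MacMahon_weight x)"
    by (induction s) (simp_all add: MacMahon_weight_def power_add fps_inverse_mult mult_ac)
  finally show ?thesis .
qed

lemma MacMahon_weight_prod_nth:
  assumes "x \<in> set s" "n < x"
  shows "fps_nth (\<Prod>x\<leftarrow>s. MacMahon_weight x) n = 0"
proof -
  have "MacMahon_weight x dvd (\<Prod>x\<leftarrow>s. MacMahon_weight x)"
    using assms(1) by (induction s) auto
  then have "fps_X ^ x dvd (\<Prod>x\<leftarrow>s. MacMahon_weight x)"
    unfolding MacMahon_weight_def by (rule dvd_mult_left)
  with assms(2) show ?thesis by (simp add: fps_X_power_dvd_iff)
qed

lemma MacMahon_trunc_nth:
  assumes "n \<le> N"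
  shows "fps_nth (MacMahon_trunc k N) n =
    (\<Sum>s | s \<in> increasing_tuples k \<and> fps_nth (\<Prod>x\<leftarrow>s. MacMahon_weight x) n \<noteq> 0.
       fps_nth (\<Prod>x\<leftarrow>s. MacMahon_weight x) n)"
  unfolding MacMahon_trunc_def fps_sum_nth
proof (rule sum.mono_neutral_right)
  have "x \<le> N" if "fps_nth (\<Prod>x\<leftarrow>s. MacMahon_weight x) n \<noteq> 0" "x \<in> set s" for s x
    using MacMahon_weight_prod_nth[of x s n] that assms by linarith
  then show "{s \<in> increasing_tuples k. fps_nth (\<Prod>x\<leftarrow>s. MacMahon_weight x) n \<noteq> 0} \<subseteq> bounded_tuples k N"
    by (auto simp: bounded_tuples_def)
qed (simp add: finite_bounded_tuples, auto simp: bounded_tuples_def)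

text \<open>Tuples with an entry above \<open>n\<close> contribute nothing to coefficient
  \<open>n\<close>, so the infinite sum and every truncation at \<open>N \<ge> n\<close> agree
  there.\<close>

lemma MacMahon_A_nth:
  assumes "n \<le> N"
  shows "fps_nth (MacMahon_A k) n = fps_nth (MacMahon_trunc k N) n"
proof -
  let ?G = "\<lambda>s. \<Prod>x\<leftarrow>s. MacMahon_weight x"
  have "(?G has_sum Abs_fps (\<lambda>n. fps_nth (MacMahon_trunc k n) n)) (increasing_tuples k)"
  proof (rule has_sum_fpsI)
    fix n
    have "{s \<in> increasing_tuples k. fps_nth (?G s) n \<noteq> 0} \<subseteq> bounded_tuples k n"
      using MacMahon_weight_prod_nth[where n = n] by (force simp: bounded_tuples_def not_le[symmetric])
    then show "finite {s \<in> increasing_tuples k. fps_nth (?G s) n \<noteq> 0}"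
      using finite_bounded_tuples by (rule finite_subset)
    show "fps_nth (Abs_fps (\<lambda>n. fps_nth (MacMahon_trunc k n) n)) n =
        (\<Sum>s | s \<in> increasing_tuples k \<and> fps_nth (?G s) n \<noteq> 0. fps_nth (?G s) n)"
      by (simp add: MacMahon_trunc_nth[OF order.refl])
  qed
  then have "(\<Sum>\<^sub>\<infinity>s\<in>increasing_tuples k. ?G s) = Abs_fps (\<lambda>n. fps_nth (MacMahon_trunc k n) n)"
    by (rule infsumI)
  moreover have "MacMahon_A k = (\<Sum>\<^sub>\<infinity>s\<in>increasing_tuples k. ?G s)"
    unfolding MacMahon_A_def
    by (rule infsum_cong) (simp add: MacMahon_summand_eq increasing_tuples_def)
  ultimately show ?thesis
    by (simp add: MacMahon_trunc_nth[OF order.refl] MacMahon_trunc_nth[OF assms])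
qed

section \<open>The limit of the closed form and the truncated sum\<close>

text \<open>By the quotient formula the closed form involves four q-factorials on the left and one
  on the right. Modulo \<open>fps_X ^ Suc i\<close> each is the infinite product, which leaves its
  inverse cube. The hypothesis makes the smallest index, \<open>N - k\<close>, at least
  \<open>i\<close>.\<close>

lemma MacMahon_comb_cong:
  assumes "k + i \<le> N"
  shows "fps_X ^ Suc i dvd MacMahon_comb k N - fps_X ^ triangle k * inverse (qpochhammer_inf fps_X ^ 3)"
proof -
  let ?d = "(fps_X :: rat fps) ^ Suc i" and ?q = "qpochhammer_inf fps_X"
  have q: "?d dvd qfact fps_X M - ?q" if "i \<le> M" for M
  proof -
    have "?d dvd fps_X ^ Suc M" using that by (intro le_imp_power_dvd) auto
    then show ?thesis using qfact_cong_qpochhammer_inf by (rule dvd_trans)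
  qed
  let ?D = "MacMahon_comb k N" and ?f = "qfact fps_X :: nat \<Rightarrow> rat fps"
  have "?D * ((?f N)\<^sup>2 * (?f (N + k + 1) * ?f (N - k))) =
      fps_X ^ triangle k * (qbinomial fps_X (2 * N + 1) (N + k + 1) * ?f (N + k + 1) * ?f (N - k))"
    using MacMahon_comb_eq[of k N] by (simp only: mult.assoc[symmetric])
  also have "qbinomial fps_X (2 * N + 1) (N + k + 1) * ?f (N + k + 1) * ?f (N - k) = ?f (2 * N + 1)"
    using qbinomial_qfact[of fps_X "N + k + 1" "N - k"] assms by (simp add: mult_2 del: qfact_Suc)
  finally have eq: "?D * ((?f N)\<^sup>2 * (?f (N + k + 1) * ?f (N - k))) = fps_X ^ triangle k * ?f (2 * N + 1)" .
  have 1: "?d dvd ?D * ((?f N)\<^sup>2 * (?f (N + k + 1) * ?f (N - k))) - ?D * (?q\<^sup>2 * (?q * ?q))"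
    using assms by (intro dvd_mult_diff_mult dvd_power_diff_power q) auto
  have 2: "?d dvd fps_X ^ triangle k * ?f (2 * N + 1) - fps_X ^ triangle k * ?q"
    using assms by (intro dvd_mult_diff_mult q) auto
  have "?d dvd (fps_X ^ triangle k * ?f (2 * N + 1) - fps_X ^ triangle k * ?q) -
      (?D * ((?f N)\<^sup>2 * (?f (N + k + 1) * ?f (N - k))) - ?D * (?q\<^sup>2 * (?q * ?q)))"
    by (rule dvd_diff[OF 2 1])
  then have "?d dvd ?D * ?q ^ 4 - fps_X ^ triangle k * ?q"
    unfolding eq by (simp add: power2_eq_square power4_eq_xxxx mult_ac del: power_Suc)
  then have "?d dvd (?D * ?q ^ 4 - fps_X ^ triangle k * ?q) * inverse ?q ^ 4"
    by (rule dvd_mult2)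
  also have "(?D * ?q ^ 4 - fps_X ^ triangle k * ?q) * inverse ?q ^ 4 =
      ?D * (?q * inverse ?q) ^ 4 - fps_X ^ triangle k * ((?q * inverse ?q) * inverse ?q ^ 3)"
    by (simp add: algebra_simps power4_eq_xxxx power3_eq_cube)
  also have "?q * inverse ?q = 1"
    using inverse_mult_eq_1[of ?q] qpochhammer_inf_nth_0 by (simp add: mult.commute)
  finally show ?thesis by (simp add: fps_inverse_power del: power_Suc)
qed

text \<open>The sum is the part \<open>k \<le> l \<le> k + j\<close> of
  \<open>MacMahon_comb k N\<close>, with \<open>l = m + k\<close>. For smaller \<open>l\<close> the
  binomial vanishes; for larger \<open>l\<close> the series starts at or after exponent
  \<open>triangle (k + j + 1)\<close>.\<close>

lemma MacMahon_sum_nth: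
  assumes "i < triangle (k + j + 1)"
  shows "fps_nth (\<Sum>m=0..j. of_nat ((2 * m + 2 * k + 1) choose (m + 2 * k + 1)) * MacMahon_A (m + k)) i =
    fps_nth (fps_X ^ triangle k * inverse (qpochhammer_inf fps_X ^ 3)) i"
proof -
  \<comment> \<open>Large enough for \<open>MacMahon_comb_cong\<close>, for the range up to
    \<open>k + j\<close>, and for \<open>MacMahon_A_nth\<close> at \<open>i\<close>.\<close>
  define N where "N = k + j + i"
  let ?c = "\<lambda>l. (2 * l + 1) choose (l + k + 1)"
  have "fps_nth (fps_X ^ triangle k * inverse (qpochhammer_inf fps_X ^ 3)) i = fps_nth (MacMahon_comb k N) i"
    using MacMahon_comb_cong[of k i N] by (auto simp: N_def fps_X_power_dvd_iff simp del: power_Suc)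
  also have "\<dots> = (\<Sum>l\<le>N. of_nat (?c l) * fps_nth (MacMahon_trunc l N) i)"
    by (simp add: MacMahon_comb_def fps_sum_nth fps_mult_of_nat_nth del: binomial_Suc_Suc)
  also have "\<dots> = (\<Sum>l=k..k+j. of_nat (?c l) * fps_nth (MacMahon_trunc l N) i)"
  proof (rule sum.mono_neutral_right)
    show "\<forall>l\<in>{..N} - {k..k + j}. of_nat (?c l) * fps_nth (MacMahon_trunc l N) i = 0"
    proof
      fix l assume l: "l \<in> {..N} - {k..k + j}"
      show "of_nat (?c l) * fps_nth (MacMahon_trunc l N) i = 0"
      proof (cases "l < k")
        case False
        with l have "triangle (k + j + 1) \<le> triangle l"
          by (intro triangle_mono) auto
        then show ?thesis
          using MacMahon_trunc_dvd[of l N] assms by (simp add: fps_X_power_dvd_iff)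
      qed (simp add: binomial_eq_0 del: binomial_Suc_Suc)
    qed
  qed (auto simp: N_def)
  also have "\<dots> = (\<Sum>m=0..j. of_nat (?c (m + k)) * fps_nth (MacMahon_trunc (m + k) N) i)"
    using sum.shift_bounds_cl_nat_ivl[of "\<lambda>l. of_nat (?c l) * fps_nth (MacMahon_trunc l N) i" 0 k j]
    by (simp add: add.commute)
  also have "\<dots> = (\<Sum>m=0..j. of_nat ((2 * m + 2 * k + 1) choose (m + 2 * k + 1)) * fps_nth (MacMahon_A (m + k)) i)"
    by (intro sum.cong refl) (simp add: MacMahon_A_nth[of i N] N_def mult_2 add_ac)
  finally show ?thesis
    by (simp add: fps_sum_nth fps_mult_of_nat_nth del: binomial_Suc_Suc)
qed

section \<open>The generating function of 3-colored partitions\<close>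

text \<open>Colored partitions are the case \<open>w = fst\<close>; an arbitrary \<open>S\<close>
  permits induction on the set of available colored parts.\<close>

definition weighted_multisets :: "('a \<Rightarrow> nat) \<Rightarrow> 'a set \<Rightarrow> nat \<Rightarrow> 'a multiset set" where
  "weighted_multisets w S n = {P. set_mset P \<subseteq> S \<and> (\<Sum>x\<in>#P. w x) = n}"

text \<open>Either \<open>s\<close> does not occur, or one copy is removed while \<open>s\<close>
  stays available.\<close>

lemma weighted_multisets_insert:
  "weighted_multisets w (insert s S) n = weighted_multisets w S n \<union>
     (if w s \<le> n then add_mset s ` weighted_multisets w (insert s S) (n - w s) else {})"
  (is "?L = ?R")
proof
  show "?L \<subseteq> ?R"
  proof
    fix P assume P: "P \<in> ?L"
    show "P \<in> ?R"
    proof (cases "s \<in># P")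
      case True
      then obtain Q where "P = add_mset s Q" by (metis mset_add)
      with P show ?thesis by (auto simp: weighted_multisets_def)
    qed (use P in \<open>auto simp: weighted_multisets_def\<close>)
  qed
qed (auto simp: weighted_multisets_def split: if_splits)

lemma finite_weighted_multisets:
  assumes "finite S" "\<forall>x\<in>S. 0 < w x"
  shows "finite (weighted_multisets w S n)"
  using assms
proof (induction S arbitrary: n rule: finite_induct)
  case empty
  have "weighted_multisets w {} n \<subseteq> {{#}}" by (auto simp: weighted_multisets_def)
  then show ?case by (rule finite_subset) simp
next
  case (insert s S)
  show ?case
  proof (induction n rule: less_induct)
    case (less n)
    then show ?case
      unfolding weighted_multisets_insert[of w s S n] using insert by simp
  qed
qed

text \<open>By the preceding recursion, multiplying by \<open>1 - fps_X ^ w s\<close> removes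
  \<open>s\<close> from the available parts. Positive weights keep the sets finite, so that
  \<open>card\<close> counts them.\<close>

lemma weighted_multisets_gf:
  fixes w :: "'a \<Rightarrow> nat"
  assumes "finite S" "\<forall>x\<in>S. 0 < w x"
  shows "Abs_fps (\<lambda>n. of_nat (card (weighted_multisets w S n))) * (\<Prod>x\<in>S. 1 - fps_X ^ w x) =
    (1 :: 'b::comm_ring_1 fps)"
  using assms
proof (induction S rule: finite_induct)
  case empty
  have "weighted_multisets w {} n = (if n = 0 then {{#}} else {})" for n
    by (auto simp: weighted_multisets_def)
  then show ?case by (auto simp: fps_eq_iff)
next
  case (insert s S)
  let ?G = "\<lambda>S. Abs_fps (\<lambda>n. of_nat (card (weighted_multisets w S n))) :: 'b fps"
  have card: "card (weighted_multisets w (insert s S) n) = card (weighted_multisets w S n) +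
      (if w s \<le> n then card (weighted_multisets w (insert s S) (n - w s)) else 0)" for n
  proof -
    have "weighted_multisets w S n \<inter> add_mset s ` A = {}" for A
      using insert.hyps by (auto simp: weighted_multisets_def)
    moreover have "finite (weighted_multisets w S m)" "finite (weighted_multisets w (insert s S) m)" for m
      using insert by (auto intro!: finite_weighted_multisets)
    ultimately show ?thesis
      unfolding weighted_multisets_insert[of w s S n]
      by (auto simp: card_Un_disjoint card_image inj_on_def)
  qed
  have "?G (insert s S) = ?G S + fps_X ^ w s * ?G (insert s S)"
    by (rule fps_ext) (subst fps_nth_Abs_fps, subst card, auto simp: fps_X_power_mult_nth)
  then have "?G (insert s S) * (1 - fps_X ^ w s) = ?G S"
    by (simp add: algebra_simps)
  then show ?case
    using insert by (simp add: mult.assoc[symmetric])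
qed

lemma colored_partitions3_eq:
  assumes "n \<le> N"
  shows "colored_partitions3 n = weighted_multisets fst ({1..N} \<times> UNIV) n"
proof (intro equalityI subsetI)
  fix P assume P: "P \<in> colored_partitions3 n"
  have "part \<le> N" if "(part, color) \<in># P" for part color
  proof -
    from that obtain Q where "P = add_mset (part, color) Q" by (metis mset_add)
    then show ?thesis using P assms by (auto simp: colored_partitions3_def)
  qed
  with P show "P \<in> weighted_multisets fst ({1..N} \<times> UNIV) n"
    by (fastforce simp: colored_partitions3_def weighted_multisets_def case_prod_unfold Suc_le_eq)
qed (fastforce simp: colored_partitions3_def weighted_multisets_def case_prod_unfold)

text \<open>For coefficient \<open>n\<close> only parts up to \<open>n\<close> matter; the three
  colors cube the finite product, which agrees with the infinite one modulo
  \<open>fps_X ^ Suc n\<close>.\<close>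

lemma p3_gf: "Abs_fps (\<lambda>n. of_nat (p3 n)) = inverse (qpochhammer_inf fps_X ^ 3)"
proof (rule fps_ext)
  fix n
  let ?q = "qpochhammer_inf fps_X"
  let ?G = "Abs_fps (\<lambda>m. of_nat (card (weighted_multisets fst ({1..n} \<times> (UNIV :: 3 set)) m))) :: rat fps"
  have "(\<Prod>x\<in>{1..n} \<times> (UNIV :: 3 set). 1 - fps_X ^ fst x :: rat fps) = (\<Prod>i\<in>{1..n}. (1 - fps_X ^ i) ^ 3)"
    using prod.cartesian_product[of "\<lambda>i c. 1 - fps_X ^ i :: rat fps" "UNIV :: 3 set" "{1..n}"]
    by (simp add: case_prod_unfold)
  also have "\<dots> = (\<Prod>i\<in>{1..n}. 1 - fps_X ^ i) ^ 3"
    by (simp add: prod_power_distrib)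
  also have "(\<Prod>i\<in>{1..n}. 1 - fps_X ^ i :: rat fps) = qfact fps_X n"
    by (induction n) auto
  finally have G: "?G * qfact fps_X n ^ 3 = 1"
    using weighted_multisets_gf[of "{1..n} \<times> (UNIV :: 3 set)" fst, where ?'b = rat] by simp
  have "fps_X ^ Suc n dvd ?G * qfact fps_X n ^ 3 - ?G * ?q ^ 3"
    by (intro dvd_mult_diff_mult dvd_power_diff_power qfact_cong_qpochhammer_inf) auto
  then have "fps_X ^ Suc n dvd (?G * qfact fps_X n ^ 3 - ?G * ?q ^ 3) * inverse (?q ^ 3)"
    by (rule dvd_mult2)
  also have "(?G * qfact fps_X n ^ 3 - ?G * ?q ^ 3) * inverse (?q ^ 3) =
      inverse (?q ^ 3) - ?G * (inverse (?q ^ 3) * ?q ^ 3)"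
    unfolding G by (simp only: algebra_simps mult_1)
  also have "inverse (?q ^ 3) * ?q ^ 3 = 1"
    by (rule inverse_mult_eq_1) (simp add: fps_nth_power_0 qpochhammer_inf_nth_0)
  finally have "fps_nth (inverse (?q ^ 3)) n = fps_nth ?G n"
    by (simp add: fps_X_power_dvd_iff del: power_Suc)
  then show "fps_nth (Abs_fps (\<lambda>n. of_nat (p3 n))) n = fps_nth (inverse (?q ^ 3)) n"
    by (simp add: p3_def colored_partitions3_eq[of n n])
qed

section \<open>Passage to Laurent series and the final identities\<close>

lemma fps_to_fls_sum: "fps_to_fls (\<Sum>x\<in>A. f x) = (\<Sum>x\<in>A. fps_to_fls (f x))"
  by (induction A rule: infinite_finite_induct) auto

theorem corollary1p2:
  fixes k j :: nat
  shows "(\<exists>R\<in>O_q ((j + 1) * (j + 2 * k + 2) div 2).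
            fps_to_fls (1 / qpochhammer_inf fps_X ^ 3) =
              fls_X_intpow (- int ((k\<^sup>2 + k) div 2)) *
                (\<Sum>m=0..j. of_nat ((2 * m + 2 * k + 1) choose (m + 2 * k + 1)) *
                   fps_to_fls (MacMahon_A (m + k)))
              + fps_to_fls R) \<and>
         (\<forall>n. n < (j + 1) * (j + 2 * k + 2) div 2 \<longrightarrow>
            of_nat (p3 n) =
              (\<Sum>m=0..j. of_nat ((2 * m + 2 * k + 1) choose (m + 2 * k + 1)) *
                 MacMahon_coeff (m + k) (n + (k\<^sup>2 + k) div 2)))"
proof -
  let ?c = "\<lambda>m. (2 * m + 2 * k + 1) choose (m + 2 * k + 1)"
  define B where "B = (j + 1) * (j + 2 * k + 2) div 2"
  define P where "P = inverse (qpochhammer_inf fps_X ^ 3)"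
  define S where "S = (\<Sum>m=0..j. of_nat (?c m) * MacMahon_A (m + k))"
  define t where "t = triangle k"
  define R where "R = fps_shift t (fps_X ^ t * P - S)"
  have t: "(k\<^sup>2 + k) div 2 = t"
    by (simp add: t_def triangle_def power2_eq_square algebra_simps)
  have "2 * triangle n = n * (n + 1)" for n
    by (induction n) auto
  from this[of "k + j + 1"] this[of k]
  \<comment> \<open>The claimed error exponent is exactly the order of the first omitted series
    minus the shift: \<open>triangle (k + j + 1) - triangle k\<close>.\<close>
  have "2 * triangle (k + j + 1) = 2 * t + (j + 1) * (j + 2 * k + 2)"
    unfolding t_def by (simp add: algebra_simps)
  then have tB: "triangle (k + j + 1) = t + B"
    unfolding B_def using even_error_exponent[of j k] by linarith
  have SP: "fps_nth S i = fps_nth (fps_X ^ t * P) i" if "i < t + B" for i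
    unfolding S_def P_def t_def by (rule MacMahon_sum_nth) (use that tB in simp)
  have "R \<in> O_q B"
    using SP by (simp add: R_def O_q_def)
  moreover have "fps_to_fls (1 / qpochhammer_inf fps_X ^ 3) =
      fls_X_intpow (- int ((k\<^sup>2 + k) div 2)) *
        (\<Sum>m=0..j. of_nat (?c m) * fps_to_fls (MacMahon_A (m + k))) + fps_to_fls R"
  proof -
    have X: "fps_to_fls (fps_X ^ t :: rat fps) = fls_X_intpow (int t)"
      by (simp add: fps_to_fls_power fls_X_power_conv_shift_1)
    have I: "fls_X_intpow (- int t) * (fls_X_intpow (int t) * f) = f" for f :: "rat fls"
      by (simp only: mult.assoc[symmetric] fls_X_intpow_times_fls_X_intpow) simp
    \<comment> \<open>The shift in \<open>R\<close> loses nothing, because the first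
      \<open>t\<close> coefficients of \<open>fps_X ^ t * P - S\<close> are zero. The identity is
      then moved to Laurent series, where \<open>fps_X ^ t\<close> becomes invertible.\<close>
    have "fps_X ^ t * R = fps_X ^ t * P - S"
      unfolding R_def by (rule fps_ext) (use SP in \<open>simp add: fps_X_power_mult_nth\<close>)
    then have "fps_X ^ t * P = S + fps_X ^ t * R" by simp
    then have "fps_to_fls (fps_X ^ t * P) = fps_to_fls (S + fps_X ^ t * R)" by simp
    then have "fls_X_intpow (int t) * fps_to_fls P = fps_to_fls S + fls_X_intpow (int t) * fps_to_fls R"
      by (simp only: fls_times_fps_to_fls fps_to_fls_plus X)
    then have "fls_X_intpow (- int t) * (fls_X_intpow (int t) * fps_to_fls P) =
        fls_X_intpow (- int t) * fps_to_fls S + fls_X_intpow (- int t) * (fls_X_intpow (int t) * fps_to_fls R)"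
      by (simp only: distrib_left)
    then have "fps_to_fls P = fls_X_intpow (- int t) * fps_to_fls S + fps_to_fls R"
      by (simp only: I)
    moreover have "fps_to_fls S = (\<Sum>m=0..j. of_nat (?c m) * fps_to_fls (MacMahon_A (m + k)))"
      unfolding S_def by (simp only: fps_to_fls_sum fls_times_fps_to_fls fps_to_fls_of_nat)
    moreover have "1 / qpochhammer_inf fps_X ^ 3 = P"
      unfolding P_def by (subst fps_divide_unit) (simp_all add: fps_nth_power_0 qpochhammer_inf_nth_0)
    ultimately show ?thesis unfolding t by simp
  qed
  moreover have "of_nat (p3 n) = (\<Sum>m=0..j. of_nat (?c m) * MacMahon_coeff (m + k) (n + (k\<^sup>2 + k) div 2))"
    if "n < B" for n
  proof -
    have "of_nat (p3 n) = fps_nth P n"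
      unfolding P_def p3_gf[symmetric] by simp
    also have "\<dots> = fps_nth S (n + t)"
      using SP[of "n + t"] that by (simp add: fps_X_power_mult_nth)
    finally show ?thesis
      unfolding t S_def by (simp add: fps_sum_nth fps_mult_of_nat_nth MacMahon_coeff_def del: binomial_Suc_Suc)
  qed
  ultimately show ?thesis unfolding B_def by blast
qed

end
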